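(* Assume $\mathfrak{b}=\mathfrak{c}$. If $(p_n)_{n<\omega}$ is an RK-increasing sequence of P-points (i.e. $p_n<_{RK}p_{n+1}$ for every $n$), then there exists a P-point $u$ such that $u>_{RK}p_n$ for each $n<\omega$.
   Context: $\mathfrak{b}$ is the bounding number and $\mathfrak{c}=2^{\aleph_0}$. A free ultrafilter $u$ on $\omega$ is a P-point if for every partition $(V_n)_{n<\omega}$ of $\omega$ there is $U\in u$ with either $U\subseteq V_n$ for some $n$ or $U\cap V_n$ finite for all $n$. For filters $\mathcal{F},\mathcal{G}$ on $\omega$, $\mathcal{F}\ge_{RK}\mathcal{G}$ if there is a map $h:\omega\to\omega$ with $h^{-1}(G)\in\mathcal{F}$ for all $G\in\mathcal{G}$; $\mathcal{F}>_{RK}\mathcal{G}$ means $\mathcal{F}\ge_{RK}\mathcal{G}$ and not $\mathcal{G}\ge_{RK}\mathcal{F}$. *)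

theory Defs
  imports Complex_Main "HOL-Library.Disjoint_Sets"
begin

unbundle cardinal_syntax

definition eventually_dominated :: "(nat \<Rightarrow> nat) \<Rightarrow> (nat \<Rightarrow> nat) \<Rightarrow> bool" (infix \<open>\<le>\<^sup>*\<close> 50) where
  "f \<le>\<^sup>* g \<longleftrightarrow> (\<forall>\<^sub>F n in sequentially. f n \<le> g n)"

definition unbounded_family :: "(nat \<Rightarrow> nat) set \<Rightarrow> bool" where
  "unbounded_family B \<longleftrightarrow> \<not> (\<exists>g. \<forall>f\<in>B. f \<le>\<^sup>* g)"

(* Cardinals are only determined up to =o, so SOME picks a representative of the least one;
   bounding_number_attained and bounding_number_least show that it exists. *)
definition bounding_number :: "(nat \<Rightarrow> nat) rel" where
  "bounding_number = (SOME r. (\<exists>B. unbounded_family B \<and> r = |B| ) \<and>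
     (\<forall>B. unbounded_family B \<longrightarrow> r \<le>o |B| ))"

definition continuum :: "(nat \<Rightarrow> bool) rel" where
  "continuum = ctwo ^c natLeq"

lemma unbounded_family_UNIV: "unbounded_family UNIV"
proof -
  have "\<not> (\<lambda>n. Suc (g n)) \<le>\<^sup>* g" for g
    by (simp add: eventually_dominated_def)
  then show ?thesis
    unfolding unbounded_family_def by blast
qed

lemma bounding_number_spec:
  "(\<exists>B. unbounded_family B \<and> bounding_number = |B| ) \<and>
   (\<forall>B. unbounded_family B \<longrightarrow> bounding_number \<le>o |B| )"
proof -
  let ?R = "{r. \<exists>B. unbounded_family B \<and> r = |B|}"
  have "\<exists>r\<in>?R. \<forall>r'\<in>?R. r \<le>o r'"
    by (rule exists_minim_Card_order) (use unbounded_family_UNIV card_of_Card_order in auto)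
  then have "\<exists>r. (\<exists>B. unbounded_family B \<and> r = |B| ) \<and>
     (\<forall>B. unbounded_family B \<longrightarrow> r \<le>o |B| )"
    by blast
  then show ?thesis
    unfolding bounding_number_def by (rule someI_ex)
qed

lemma bounding_number_attained: "\<exists>B. unbounded_family B \<and> bounding_number = |B|"
  using bounding_number_spec by blast

lemma bounding_number_least: "unbounded_family B \<Longrightarrow> bounding_number \<le>o |B|"
  using bounding_number_spec by blast

(* The type nat filter includes the improper filter bot, excluded in the first conjunct. *)
definition ultrafilter :: "nat filter \<Rightarrow> bool" where
  "ultrafilter F \<longleftrightarrow> F \<noteq> bot \<and>
     (\<forall>A. (\<forall>\<^sub>F n in F. n \<in> A) \<or> (\<forall>\<^sub>F n in F. n \<notin> A))"

definition free_ultrafilter :: "nat filter \<Rightarrow> bool" where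
  "free_ultrafilter F \<longleftrightarrow> ultrafilter F \<and> (\<forall>A. (\<forall>\<^sub>F n in F. n \<in> A) \<longrightarrow> infinite A)"

(* The blocks V n may be empty, so partitions into finitely many pieces are included;
   for those the condition holds in every ultrafilter. *)
definition P_point :: "nat filter \<Rightarrow> bool" where
  "P_point u \<longleftrightarrow> free_ultrafilter u \<and>
     (\<forall>V :: nat \<Rightarrow> nat set. disjoint_family V \<and> (\<Union>n. V n) = UNIV \<longrightarrow>
        (\<exists>U. (\<forall>\<^sub>F k in u. k \<in> U) \<and> ((\<exists>n. U \<subseteq> V n) \<or> (\<forall>n. finite (U \<inter> V n)))))"

definition RK_ge :: "nat filter \<Rightarrow> nat filter \<Rightarrow> bool" (infix \<open>\<ge>\<^sub>R\<^sub>K\<close> 50) where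
  "F \<ge>\<^sub>R\<^sub>K G \<longleftrightarrow>
     (\<exists>h. \<forall>A. (\<forall>\<^sub>F n in G. n \<in> A) \<longrightarrow> (\<forall>\<^sub>F n in F. n \<in> h -` A))"

definition RK_greater :: "nat filter \<Rightarrow> nat filter \<Rightarrow> bool" (infix \<open>>\<^sub>R\<^sub>K\<close> 50) where
  "F >\<^sub>R\<^sub>K G \<longleftrightarrow> F \<ge>\<^sub>R\<^sub>K G \<and> \<not> G \<ge>\<^sub>R\<^sub>K F"

end

theory Submission
  imports Defs "HOL-Library.Nat_Bijection"
begin

text \<open>
  Let f k map p (k + 1) to p k, and let g k send (n, y) with n \<ge> k to f k (f (k + 1) (... (f (n - 1) y))).
  The sets {(n, y). n \<ge> k \<and> g k (n, y) \<in> B} with B in p k generate a filter F; any ultrafilter above F is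
  RK-above every p k, hence strictly so, as the sequence p is strictly increasing. A family of sets is
  compatible with F iff the image under g k of each finite intersection, cut down to n \<ge> k, lies in p k
  for every k. A P-point above F is built by transfinite recursion of length c, adding for each
  v : omega to omega a set on which v is constant or finite-to-one. If no fibre of v is compatible with what
  has been chosen so far, then P-pointness of p k yields, for each finite intersection A of earlier sets
  and each k, a function q such that the image of A \<inter> {x. x \<le> h (v x)} remains in p k whenever h
  eventually dominates q. There are fewer than c = b such functions q, so a single h serves them all,
  and v is finite-to-one on {x. x \<le> h (v x)}.
\<close>

section \<open>Cardinalities of index sets and of the set of all functions on omega\<close>

lemma card_of_finite_subsets_le:
  assumes "infinite A"
  shows "|{T. finite T \<and> T \<subseteq> A}| \<le>o |A|"
proof -
  have *: "|{xs. set xs \<subseteq> A \<and> length xs = n}| \<le>o |A|" for n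
  proof (induction n)
    case 0
    have "{xs. set xs \<subseteq> A \<and> length xs = 0} = {[]}" by auto
    moreover have "A \<noteq> {}" using assms by auto
    ultimately show ?case by (simp add: card_of_singl_ordLeq)
  next
    case (Suc n)
    let ?L = "{xs. set xs \<subseteq> A \<and> length xs = n}"
    have "{xs. set xs \<subseteq> A \<and> length xs = Suc n} = (\<lambda>(x, xs). x # xs) ` (A \<times> ?L)"
      by (auto simp: length_Suc_conv image_iff)
    then have "|{xs. set xs \<subseteq> A \<and> length xs = Suc n}| \<le>o |A \<times> ?L|"
      by (simp only: card_of_image)
    also have "|A \<times> ?L| \<le>o |A \<times> A|"
      by (rule card_of_Times_mono2[OF Suc])
    also have "|A \<times> A| =o |A|"
      using assms by (simp add: card_of_Times_same_infinite)
    finally show ?case .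
  qed
  have "{T. finite T \<and> T \<subseteq> A} = set ` (\<Union>n. {xs. set xs \<subseteq> A \<and> length xs = n})"
    by (auto simp: image_iff) (metis finite_list)
  then have "|{T. finite T \<and> T \<subseteq> A}| \<le>o |\<Union>n::nat. {xs. set xs \<subseteq> A \<and> length xs = n}|"
    by (simp only: card_of_image)
  also have "|\<Union>n::nat. {xs. set xs \<subseteq> A \<and> length xs = n}| \<le>o |A|"
    by (rule card_of_UNION_ordLeq_infinite) (use assms * infinite_iff_card_of_nat in auto)
  finally show ?thesis .
qed

text \<open>The pairs (T, k) index the functions that \<open>centered_extension\<close> has to
  dominate at once: T is a finite set of earlier stages and k a level of the sequence p. With r the
  bounding number, fewer than b stages give fewer than b functions.\<close>

lemma card_of_finite_subsets_Times_nat_less: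
  assumes "|A| <o r" "natLeq <o r"
  shows "|{T. finite T \<and> T \<subseteq> A} \<times> (UNIV :: nat set)| <o r"
proof (cases "finite A")
  case True
  then have "finite {T. finite T \<and> T \<subseteq> A}" by simp
  then have "|{T. finite T \<and> T \<subseteq> A}| \<le>o |UNIV :: nat set|"
    by (intro ordLess_imp_ordLeq finite_ordLess_infinite[OF card_of_Well_order card_of_Well_order])
      (simp_all add: Field_card_of)
  then have "|{T. finite T \<and> T \<subseteq> A} \<times> (UNIV :: nat set)| \<le>o |UNIV \<times> UNIV :: (nat \<times> nat) set|"
    by (rule card_of_Times_mono1)
  also have "|UNIV \<times> UNIV :: (nat \<times> nat) set| =o |UNIV :: nat set|"
    by (rule card_of_Times_same_infinite) simp
  also have "|UNIV :: nat set| =o natLeq" by (rule card_of_nat)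
  finally show ?thesis using assms(2) by (rule ordLeq_ordLess_trans)
next
  case False
  have "|{T. finite T \<and> T \<subseteq> A} \<times> (UNIV :: nat set)| \<le>o |A \<times> (UNIV :: nat set)|"
    by (rule card_of_Times_mono1[OF card_of_finite_subsets_le[OF False]])
  also have "|A \<times> (UNIV :: nat set)| =o |A|"
    using False by (auto simp: card_of_Times_infinite infinite_iff_card_of_nat)
  finally show ?thesis using assms(1) by (rule ordLeq_ordLess_trans)
qed

lemma natLeq_less_continuum: "natLeq <o continuum"
  unfolding continuum_def by (rule ordLess_ctwo_cexp) (rule natLeq_Card_order)

text \<open>This bounds the length of the recursion over all v from omega to omega. A function is
  recovered from the set of codes of the pairs in its graph.\<close>

lemma card_of_functions_le_continuum: "|UNIV :: (nat \<Rightarrow> nat) set| \<le>o continuum"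
proof -
  have "inj (\<lambda>(v :: nat \<Rightarrow> nat) c. c \<in> range (\<lambda>n. prod_encode (n, v n)))"
  proof (rule injI, rule ext)
    fix v w :: "nat \<Rightarrow> nat" and n
    assume "(\<lambda>c. c \<in> range (\<lambda>n. prod_encode (n, v n))) = (\<lambda>c. c \<in> range (\<lambda>n. prod_encode (n, w n)))"
    then have "prod_encode (n, v n) \<in> range (\<lambda>n. prod_encode (n, w n))"
      by (auto dest: fun_cong[where x = "prod_encode (n, v n)"])
    then show "v n = w n" by auto
  qed
  then have "|UNIV :: (nat \<Rightarrow> nat) set| \<le>o |UNIV :: (nat \<Rightarrow> bool) set|"
    by (rule card_of_ordLeqI) simp
  also have "|UNIV :: (nat \<Rightarrow> bool) set| = continuum"
    unfolding continuum_def cexp_def ctwo_def Field_natLeq Field_card_of Func_def by simp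
  finally show ?thesis .
qed

lemma dominated_if_small:
  fixes H :: "'i \<Rightarrow> nat \<Rightarrow> nat"
  assumes "|I| <o bounding_number"
  shows "\<exists>h. \<forall>i\<in>I. H i \<le>\<^sup>* h"
proof (rule ccontr)
  assume "\<not> ?thesis"
  then have "unbounded_family (H ` I)"
    unfolding unbounded_family_def by auto
  then have "bounding_number \<le>o |I|"
    using bounding_number_least card_of_image ordLeq_transitive by blast
  then show False using assms not_ordLess_ordLeq by blast
qed

section \<open>P-points, and a single step of the recursion\<close>

lemma P_point_finite_imp_not:
  assumes "P_point p" "finite A"
  shows "\<forall>\<^sub>F y in p. y \<notin> A"
  using assms unfolding P_point_def free_ultrafilter_def ultrafilter_def by blast

lemma ultrafilter_frequently_eq_eventually:
  assumes "ultrafilter F"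
  shows "frequently P F = eventually P F"
proof
  assume "frequently P F"
  then have "\<not> (\<forall>\<^sub>F n in F. n \<notin> {n. P n})" by (simp add: frequently_def)
  then have "\<forall>\<^sub>F n in F. n \<in> {n. P n}" using assms unfolding ultrafilter_def by blast
  then show "eventually P F" by simp
qed (use assms in \<open>simp add: ultrafilter_def eventually_frequently\<close>)

text \<open>Partition omega by the first n with y outside \<open>D n\<close>, shifted by one so that
  block 0 is kept for the points of all \<open>D n\<close>. A set U of p inside block k + 1 would
  miss \<open>D k\<close>; inside block 0 it lies in every \<open>D n\<close>; if it meets every
  block in a finite set, then U - \<open>D n\<close> is covered by the blocks 1 to n + 1.\<close>

lemma P_point_pseudo_intersection:
  assumes P: "P_point p" and D: "\<And>n :: nat. \<forall>\<^sub>F y in p. y \<in> D n"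
  obtains U where "\<forall>\<^sub>F y in p. y \<in> U" "\<And>n. finite (U - D n)"
proof -
  define r where "r y = (if \<exists>n. y \<notin> D n then Suc (LEAST n. y \<notin> D n) else 0)" for y
  define V where "V n = {y. r y = n}" for n
  have "disjoint_family V" "(\<Union>n. V n) = UNIV"
    by (auto simp: V_def disjoint_family_on_def)
  then obtain U where U: "\<forall>\<^sub>F k in p. k \<in> U"
    and alt: "(\<exists>n. U \<subseteq> V n) \<or> (\<forall>n. finite (U \<inter> V n))"
    using P unfolding P_point_def by blast
  have nb: "p \<noteq> bot"
    using P by (simp add: P_point_def free_ultrafilter_def ultrafilter_def)
  have r_Suc: "y \<notin> D n" if "r y = Suc n" for y n
    using that by (auto simp: r_def split: if_splits dest: LeastI)
  have r_le: "0 < r y \<and> r y \<le> Suc n" if "y \<notin> D n" for y n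
    using that by (auto simp: r_def intro: Least_le)
  have "finite (U - D n)" for n
    using alt
  proof
    assume "\<exists>m. U \<subseteq> V m"
    then obtain m where m: "U \<subseteq> V m" ..
    show ?thesis
    proof (cases m)
      case 0
      then have "U - D n = {}" using m r_le[of _ n] by (force simp: V_def)
      then show ?thesis by (simp only: finite.emptyI)
    next
      case (Suc k)
      have "\<forall>\<^sub>F y in p. False"
        using U D[of k] by eventually_elim (use m Suc r_Suc in \<open>auto simp: V_def\<close>)
      then show ?thesis using nb by simp
    qed
  next
    assume fin: "\<forall>m. finite (U \<inter> V m)"
    have "U - D n \<subseteq> (\<Union>m\<le>Suc n. U \<inter> V m)"
      using r_le by (auto simp: V_def)
    then show ?thesis using fin by (meson finite_UN finite_atMost finite_subset)
  qed
  then show ?thesis using that U by blast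
qed

text \<open>Over the points y of a pseudo-intersection U of the decreasing sets \<open>D n\<close>,
  one can choose points e y with v (e y) tending to infinity. So v o e is finite-to-one on the part
  of U inside \<open>D 0\<close>, and q n is a bound for the e y with v (e y) = n.\<close>

lemma P_point_growth_bound:
  fixes g v :: "nat \<Rightarrow> nat"
  assumes P: "P_point p"
    and D: "\<And>n. \<forall>\<^sub>F y in p. \<exists>x. g x = y \<and> Q x \<and> n \<le> v x"
  shows "\<exists>q. \<forall>h. q \<le>\<^sup>* h \<longrightarrow> (\<forall>\<^sub>F y in p. \<exists>x. g x = y \<and> Q x \<and> x \<le> h (v x))"
proof -
  define D where "D n = {y. \<exists>x. g x = y \<and> Q x \<and> n \<le> v x}" for n
  have D_in: "\<forall>\<^sub>F y in p. y \<in> D n" for n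
    using assms(2) by (simp add: D_def)
  obtain U where U: "\<forall>\<^sub>F y in p. y \<in> U" "\<And>n. finite (U - D n)"
    by (rule P_point_pseudo_intersection[OF P, of D]) (rule D_in, rule that)
  \<comment> \<open>The cap n <= y keeps the set finite, since y may lie in every
    \<open>D n\<close>. For y in \<open>D 0\<close> the set contains 0, so the maximum is
    attained.\<close>
  define m where "m y = Max {n. n \<le> y \<and> y \<in> D n}" for y
  have m: "y \<in> D (m y)" if "y \<in> D 0" for y
    using that Max_in[of "{n. n \<le> y \<and> y \<in> D n}"] by (auto simp: m_def)
  have m_ge: "n \<le> m y" if "n \<le> y" "y \<in> D n" for n y
    unfolding m_def using that by (intro Max_ge) auto
  have "\<exists>x. g x = y \<and> Q x \<and> m y \<le> v x" if "y \<in> D 0" for y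
    using m[OF that] by (simp add: D_def)
  then obtain e where e: "\<And>y. y \<in> D 0 \<Longrightarrow> g (e y) = y \<and> Q (e y) \<and> m y \<le> v (e y)"
    by metis
  have "finite {y \<in> U \<inter> D 0. v (e y) = n}" for n
  proof (rule finite_subset)
    \<comment> \<open>If y > n lies in \<open>D (Suc n)\<close>, then the cap allows Suc n, so v (e
      y) >= m y > n.\<close>
    show "{y \<in> U \<inter> D 0. v (e y) = n} \<subseteq> (U - D (Suc n)) \<union> {..n}"
      using e m_ge by (auto simp: not_le) (metis Suc_leI le_trans not_less_eq_eq)
  qed (use U in simp)
  then have "\<exists>b. \<forall>x \<in> e ` {y \<in> U \<inter> D 0. v (e y) = n}. x \<le> b" for n
    by (meson finite_imageI finite_nat_set_iff_bounded_le)
  then obtain q where q: "\<And>n y. y \<in> U \<Longrightarrow> y \<in> D 0 \<Longrightarrow> v (e y) = n \<Longrightarrow> e y \<le> q n"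
    by (simp add: image_iff) metis
  show ?thesis
  proof (intro exI[of _ q] allI impI)
    fix h assume "q \<le>\<^sup>* h"
    then obtain N where N: "\<And>n. n \<ge> N \<Longrightarrow> q n \<le> h n"
      unfolding eventually_dominated_def eventually_sequentially by auto
    \<comment> \<open>For y > N in \<open>D N\<close> the cap in \<open>m\<close> is harmless: N <=
      m y <= v (e y), and from N on h is above q.\<close>
    have "\<forall>\<^sub>F y in p. y \<notin> {..N}"
      by (rule P_point_finite_imp_not[OF P]) simp
    with U(1) D_in[of 0] D_in[of N]
    show "\<forall>\<^sub>F y in p. \<exists>x. g x = y \<and> Q x \<and> x \<le> h (v x)"
    proof eventually_elim
      case (elim y)
      have "N \<le> v (e y)" using e[of y] m_ge[of N y] elim by auto
      then have "e y \<le> h (v (e y))" using q[of y] N elim le_trans by blast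
      then show ?case using e elim by blast
    qed
  qed
qed

text \<open>The hypothesis on F makes compatibility with F a condition on the images under g k alone,
  because the p k are ultrafilters.\<close>

lemma centered_extension:
  fixes p :: "nat \<Rightarrow> nat filter" and g :: "nat \<Rightarrow> nat \<Rightarrow> nat" and X :: "'i \<Rightarrow> nat set"
  assumes P: "\<And>k. P_point (p k)"
    and ev: "\<And>Q. eventually Q F \<longleftrightarrow> (\<exists>k. \<forall>\<^sub>F y in p k. \<forall>x. g k x = y \<and> x \<in> M k \<longrightarrow> Q x)"
    and centered: "\<And>T. finite T \<Longrightarrow> T \<subseteq> S \<Longrightarrow> \<exists>\<^sub>F x in F. \<forall>w\<in>T. x \<in> X w"
    and small: "|{T. finite T \<and> T \<subseteq> S} \<times> (UNIV :: nat set)| <o bounding_number"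
  shows "\<exists>Y. ((\<exists>n. \<forall>x\<in>Y. v x = n) \<or> (\<forall>n :: nat. finite {x \<in> Y. v x = n})) \<and>
    (\<forall>T. finite T \<and> T \<subseteq> S \<longrightarrow> (\<exists>\<^sub>F x in F. x \<in> Y \<and> (\<forall>w\<in>T. x \<in> X w)))"
proof (cases "\<exists>n. \<forall>T. finite T \<and> T \<subseteq> S \<longrightarrow> (\<exists>\<^sub>F x in F. v x = n \<and> (\<forall>w\<in>T. x \<in> X w))")
  case True
  then obtain n where "\<forall>T. finite T \<and> T \<subseteq> S \<longrightarrow> (\<exists>\<^sub>F x in F. v x = n \<and> (\<forall>w\<in>T. x \<in> X w))" ..
  then show ?thesis by (intro exI[of _ "{x. v x = n}"]) auto
next
  case False
  then have "\<forall>n. \<exists>T. finite T \<and> T \<subseteq> S \<and> (\<forall>\<^sub>F x in F. \<not> (v x = n \<and> (\<forall>w\<in>T. x \<in> X w)))"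
    unfolding frequently_def by blast
  \<comment> \<open>\<open>R n\<close> is a finite set of earlier stages whose intersection already
    excludes the fibre of v over n modulo F.\<close>
  then obtain R where R: "\<And>n. finite (R n)" "\<And>n. R n \<subseteq> S"
    "\<And>n. \<forall>\<^sub>F x in F. \<not> (v x = n \<and> (\<forall>w\<in>R n. x \<in> X w))"
    by (auto dest!: choice)
  have ultra: "ultrafilter (p k)" for k
    using P by (simp add: P_point_def free_ultrafilter_def)
  have freq: "frequently Q F \<longleftrightarrow> (\<forall>k. \<forall>\<^sub>F y in p k. \<exists>x. g k x = y \<and> x \<in> M k \<and> Q x)" for Q
  proof -
    have "frequently Q F \<longleftrightarrow> (\<forall>k. \<exists>\<^sub>F y in p k. \<exists>x. g k x = y \<and> x \<in> M k \<and> Q x)"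
    proof -
      have "(\<forall>x. g k x = y \<and> x \<in> M k \<longrightarrow> \<not> Q x) \<longleftrightarrow> \<not> (\<exists>x. g k x = y \<and> x \<in> M k \<and> Q x)" for k y
        by blast
      then show ?thesis by (simp only: frequently_def ev not_ex)
    qed
    then show ?thesis by (simp only: ultrafilter_frequently_eq_eventually[OF ultra])
  qed
  \<comment> \<open>Adding all \<open>R i\<close> with i < n to T discards the fibres of v below n,
    and the enlarged finite intersection is still compatible with F.\<close>
  have above: "\<exists>\<^sub>F x in F. (\<forall>w\<in>T. x \<in> X w) \<and> n \<le> v x" if "finite T" "T \<subseteq> S" for T n
  proof -
    have "\<exists>\<^sub>F x in F. \<forall>w \<in> T \<union> (\<Union>i<n. R i). x \<in> X w"
      by (rule centered) (use that R in auto)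
    moreover have "\<forall>\<^sub>F x in F. \<forall>i\<in>{..<n}. \<not> (v x = i \<and> (\<forall>w\<in>R i. x \<in> X w))"
      by (rule eventually_ball_finite) (use R in auto)
    ultimately have "\<exists>\<^sub>F x in F. (\<forall>w \<in> T \<union> (\<Union>i<n. R i). x \<in> X w) \<and>
        (\<forall>i\<in>{..<n}. \<not> (v x = i \<and> (\<forall>w\<in>R i. x \<in> X w)))"
      by (rule frequently_eventually_frequently)
    then show ?thesis
      by (rule frequently_elim1) (auto simp: not_less[symmetric])
  qed
  let ?I = "{T. finite T \<and> T \<subseteq> S} \<times> (UNIV :: nat set)"
  have growth: "\<exists>q. \<forall>h. q \<le>\<^sup>* h \<longrightarrow>
      (\<forall>\<^sub>F y in p (snd i). \<exists>x. g (snd i) x = y \<and>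
        (x \<in> M (snd i) \<and> (\<forall>w\<in>fst i. x \<in> X w)) \<and> x \<le> h (v x))"
    if "finite (fst i)" "fst i \<subseteq> S" for i
    by (rule P_point_growth_bound[OF P]) (use above[OF that] in \<open>simp add: freq conj_assoc\<close>)
  obtain q where q: "\<And>T k h. finite T \<Longrightarrow> T \<subseteq> S \<Longrightarrow> q (T, k) \<le>\<^sup>* h \<Longrightarrow>
      \<forall>\<^sub>F y in p k. \<exists>x. g k x = y \<and> (x \<in> M k \<and> (\<forall>w\<in>T. x \<in> X w)) \<and> x \<le> h (v x)"
  proof -
    obtain q where "finite (fst i) \<and> fst i \<subseteq> S \<longrightarrow> (\<forall>h. q i \<le>\<^sup>* h \<longrightarrow>
        (\<forall>\<^sub>F y in p (snd i). \<exists>x. g (snd i) x = y \<and>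
          (x \<in> M (snd i) \<and> (\<forall>w\<in>fst i. x \<in> X w)) \<and> x \<le> h (v x)))" for i
      using choice[of "\<lambda>i q. finite (fst i) \<and> fst i \<subseteq> S \<longrightarrow> (\<forall>h. q \<le>\<^sup>* h \<longrightarrow>
        (\<forall>\<^sub>F y in p (snd i). \<exists>x. g (snd i) x = y \<and>
          (x \<in> M (snd i) \<and> (\<forall>w\<in>fst i. x \<in> X w)) \<and> x \<le> h (v x)))"] growth by blast
    from this[of "(_, _)"] show thesis by (intro that[of q]) simp
  qed
  \<comment> \<open>One h dominates all q (T, k), as there are fewer than b of them. Then {x. x <= h
    (v x)} serves as Y: its fibre over n lies in {..h n}.\<close>
  obtain h where h: "\<forall>i\<in>?I. q i \<le>\<^sup>* h"
    using dominated_if_small[OF small] by blast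
  have "finite {x \<in> {x. x \<le> h (v x)}. v x = n}" for n
    by (rule finite_subset[of _ "{..h n}"]) auto
  moreover have "\<exists>\<^sub>F x in F. x \<in> {x. x \<le> h (v x)} \<and> (\<forall>w\<in>T. x \<in> X w)" if "finite T" "T \<subseteq> S" for T
    unfolding freq
  proof
    fix k
    have "q (T, k) \<le>\<^sup>* h" using h that by blast
    from q[OF that this]
    show "\<forall>\<^sub>F y in p k. \<exists>x. g k x = y \<and> x \<in> M k \<and> x \<in> {x. x \<le> h (v x)} \<and> (\<forall>w\<in>T. x \<in> X w)"
      by eventually_elim blast
  qed
  ultimately show ?thesis by blast
qed


section \<open>The transfinite recursion and the ultrafilter it produces\<close>

text \<open>The finite intersection property of a recursively built family is checked at the latest
  stage t of T: the condition imposed at t already covers the intersection with finitely many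
  earlier stages.\<close>

lemma finite_Well_order_has_maximum:
  assumes "Well_order r" "finite T" "T \<noteq> {}" "T \<subseteq> Field r"
  shows "\<exists>t\<in>T. T \<subseteq> insert t (underS r t)"
  using assms(2-)
proof (induction T rule: finite_ne_induct)
  case (insert s T)
  then obtain t where t: "t \<in> T" "T \<subseteq> insert t (underS r t)" by auto
  have r: "trans r" "antisym r" "total_on (Field r) r"
    using assms(1) by (simp_all add: order_on_defs)
  have "s \<noteq> t" using t insert by auto
  then consider "(s, t) \<in> r" | "(t, s) \<in> r"
    using r(3) t insert.prems unfolding total_on_def by auto
  then show ?case
  proof cases
    case 1
    then show ?thesis using t \<open>s \<noteq> t\<close> by (auto simp: underS_def)
  next
    case 2
    have "T \<subseteq> underS r s"
    proof
      fix w assume "w \<in> T"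
      then have "w \<noteq> s" "w = t \<or> (w, t) \<in> r"
        using t insert.hyps by (auto simp: underS_def)
      then show "w \<in> underS r s"
        using 2 r(1) by (auto simp: underS_def dest: transD)
    qed
    then show ?thesis by auto
  qed
qed simp

text \<open>Choose for every v from omega to omega a set \<open>X v\<close> on which v is constant
  or finite-to-one, and let u be generated by F and all \<open>X v\<close>. Characteristic functions
  make u an ultrafilter; block-index functions of partitions make it a P-point.\<close>

lemma P_point_extension:
  fixes p :: "nat \<Rightarrow> nat filter" and g :: "nat \<Rightarrow> nat \<Rightarrow> nat"
  assumes bc: "bounding_number =o continuum"
    and P: "\<And>k. P_point (p k)"
    and ev: "\<And>Q. eventually Q F \<longleftrightarrow> (\<exists>k. \<forall>\<^sub>F y in p k. \<forall>x. g k x = y \<and> x \<in> M k \<longrightarrow> Q x)"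
    and nonbot: "F \<noteq> bot"
  shows "\<exists>u. P_point u \<and> u \<le> F"
proof -
  \<comment> \<open>In this cardinal order every proper initial segment is smaller than the
    continuum, hence smaller than b by \<open>bc\<close>.\<close>
  define r where "r = |UNIV :: (nat \<Rightarrow> nat) set|"
  have r: "Well_order r" "Card_order r" "Field r = UNIV"
    unfolding r_def by (rule card_of_Well_order card_of_Card_order Field_card_of)+
  define Q :: "(nat \<Rightarrow> nat) \<Rightarrow> nat set \<Rightarrow> bool" where
    "Q v Y \<longleftrightarrow> (\<exists>n. \<forall>x\<in>Y. v x = n) \<or> (\<forall>n. finite {x \<in> Y. v x = n})" for v Y
  \<comment> \<open>Only the values of X strictly below v matter, as recursion along r
    requires.\<close>
  define C :: "((nat \<Rightarrow> nat) \<Rightarrow> nat set) \<Rightarrow> (nat \<Rightarrow> nat) \<Rightarrow> nat set \<Rightarrow> bool" where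
    "C X v Y \<longleftrightarrow> (\<forall>T. finite T \<and> T \<subseteq> underS r v \<longrightarrow> (\<exists>\<^sub>F x in F. x \<in> Y \<and> (\<forall>w\<in>T. x \<in> X w)))"
    for X v Y
  have centered: "\<exists>\<^sub>F x in F. \<forall>w\<in>T. x \<in> X w"
    if T: "finite T" "\<And>v. v \<in> T \<Longrightarrow> C X v (X v)" for T X
  proof (cases "T = {}")
    case True
    then show ?thesis using nonbot by (simp add: trivial_limit_def frequently_def)
  next
    case False
    then obtain t where t: "t \<in> T" "T \<subseteq> insert t (underS r t)"
      using finite_Well_order_has_maximum[OF r(1) T(1) False] r(3) by auto
    then have "\<exists>\<^sub>F x in F. x \<in> X t \<and> (\<forall>w \<in> T - {t}. x \<in> X w)"
      using T(2)[OF t(1)] T(1) unfolding C_def by blast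
    then show ?thesis by (rule frequently_elim1) auto
  qed
  have small: "|{T. finite T \<and> T \<subseteq> underS r v} \<times> (UNIV :: nat set)| <o bounding_number" for v
  proof (rule card_of_finite_subsets_Times_nat_less)
    have "|underS r v| <o r" by (rule card_of_underS[OF r(2)]) (simp only: r(3) UNIV_I)
    also have "r \<le>o continuum" unfolding r_def by (rule card_of_functions_le_continuum)
    also have "continuum =o bounding_number" by (rule ordIso_symmetric[OF bc])
    finally show "|underS r v| <o bounding_number" .
    show "natLeq <o bounding_number"
      using natLeq_less_continuum ordIso_symmetric[OF bc] by (rule ordLess_ordIso_trans)
  qed
  have "\<exists>X. \<forall>v. Q v (X v) \<and> C X v (X v)"
  proof (rule dependent_wf_choice[of "r - Id" "\<lambda>X v Y. Q v Y \<and> C X v Y"])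
    show "wf (r - Id)" using r(1) by (simp add: well_order_on_def)
    show "(Q v Y \<and> C X v Y) = (Q v Y \<and> C X' v Y)"
      if "\<And>w. (w, v) \<in> r - Id \<Longrightarrow> X w = X' w" for X X' v Y
    proof -
      have "(\<forall>w\<in>T. x \<in> X w) = (\<forall>w\<in>T. x \<in> X' w)" if "T \<subseteq> underS r v" for x T
        using that \<open>\<And>w. (w, v) \<in> r - Id \<Longrightarrow> X w = X' w\<close>
        by (intro ball_cong) (auto simp: underS_def)
      then have "C X v Y = C X' v Y"
        unfolding C_def by (intro arg_cong[where f = All] ext imp_cong refl) simp
      then show ?thesis by simp
    qed
    show "\<exists>Y. Q v Y \<and> C X v Y"
      if "\<And>w. (w, v) \<in> r - Id \<Longrightarrow> Q w (X w) \<and> C X w (X w)" for X v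
      unfolding Q_def C_def
    proof (rule centered_extension[OF P ev _ small])
      fix T assume T: "finite T" "T \<subseteq> underS r v"
      show "\<exists>\<^sub>F x in F. \<forall>w\<in>T. x \<in> X w"
        by (rule centered[OF T(1)]) (use T that in \<open>auto simp: underS_def\<close>)
    qed
  qed
  then obtain X where X: "\<And>v. Q v (X v)" "\<And>v. C X v (X v)" by blast
  define u where "u = inf F (INF v. principal (X v))"
  have u_X: "\<forall>\<^sub>F x in u. x \<in> X v" for v
  proof -
    have "u \<le> principal (X v)" unfolding u_def by (meson INF_lower UNIV_I le_infI2)
    then show ?thesis by (simp add: le_principal)
  qed
  have u_F: "u \<le> F" by (simp add: u_def)
  \<comment> \<open>A set of u contains the intersection of a set of F with finitely many
    \<open>X v\<close>, so \<open>centered\<close> rules out the empty set.\<close>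
  have u_nonbot: "u \<noteq> bot"
  proof
    assume "u = bot"
    then have "\<forall>\<^sub>F x in u. False" by simp
    then obtain A B where A: "eventually A F" and B: "eventually B (INF v. principal (X v))"
      and AB: "\<And>x. A x \<Longrightarrow> B x \<Longrightarrow> False"
      unfolding u_def eventually_inf by blast
    from eventually_INF[THEN iffD1, OF B]
    obtain T where T: "finite T" "eventually B (INF v\<in>T. principal (X v))" by blast
    then have "\<forall>x \<in> \<Inter>(X ` T). B x"
      by (simp add: INF_principal_finite eventually_principal)
    moreover have "\<exists>\<^sub>F x in F. \<forall>w\<in>T. x \<in> X w"
      by (rule centered[OF T(1) X(2)])
    ultimately have "\<exists>\<^sub>F x in F. B x"
      by (elim frequently_elim1) auto
    from frequently_ex[OF frequently_eventually_frequently[OF this A]] AB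
    show False by blast
  qed
  \<comment> \<open>F contains every cofinite set: a finite A has a finite image under
    \<open>g 0\<close>, which the free ultrafilter \<open>p 0\<close> avoids.\<close>
  have u_inf: "infinite A" if "\<forall>\<^sub>F x in u. x \<in> A" for A
  proof
    assume "finite A"
    then have "\<forall>\<^sub>F y in p 0. y \<notin> g 0 ` A"
      by (intro P_point_finite_imp_not[OF P]) simp
    then have "\<forall>\<^sub>F x in F. x \<notin> A"
      unfolding ev by (intro exI[of _ 0]) (auto elim!: eventually_mono)
    then have "\<forall>\<^sub>F x in u. x \<notin> A" using u_F by (rule filter_leD[rotated])
    then have "\<forall>\<^sub>F x in u. False" using that by eventually_elim blast
    then show False using u_nonbot by simp
  qed
  have "(\<forall>\<^sub>F x in u. x \<in> A) \<or> (\<forall>\<^sub>F x in u. x \<notin> A)" for A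
  proof -
    \<comment> \<open>For this characteristic function the infinite set \<open>X v\<close> is the
      union of two fibres, so v is not finite-to-one on it and must be constant.\<close>
    define v :: "nat \<Rightarrow> nat" where "v x = (if x \<in> A then 1 else 0)" for x
    have "X v = {x \<in> X v. v x = 0} \<union> {x \<in> X v. v x = 1}" by (auto simp: v_def)
    then have "\<not> (\<forall>n. finite {x \<in> X v. v x = n})"
      using u_inf[OF u_X[of v]] by (metis finite_Un)
    then obtain n where n: "\<forall>x\<in>X v. v x = n" using X(1)[of v] by (auto simp: Q_def)
    show ?thesis
    proof (cases "n = 1")
      case True
      have "\<forall>\<^sub>F x in u. x \<in> A"
        using u_X[of v] by eventually_elim (use n True in \<open>auto simp: v_def split: if_splits\<close>)
      then show ?thesis ..
    next
      case False
      have "\<forall>\<^sub>F x in u. x \<notin> A"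
        using u_X[of v] by eventually_elim (use n False in \<open>auto simp: v_def split: if_splits\<close>)
      then show ?thesis ..
    qed
  qed
  moreover have "\<exists>U. (\<forall>\<^sub>F x in u. x \<in> U) \<and> ((\<exists>n. U \<subseteq> V n) \<or> (\<forall>n. finite (U \<inter> V n)))"
    if V: "disjoint_family V" "(\<Union>n. V n) = UNIV" for V :: "nat \<Rightarrow> nat set"
  proof -
    \<comment> \<open>v sends x to the index of its block, so the fibres of v are exactly the
      blocks.\<close>
    obtain v where v: "\<And>x. x \<in> V (v x)" using V(2) by (metis UNIV_I UN_iff)
    have V_eq: "V n = {x. v x = n}" for n
      using V(1) v unfolding disjoint_family_on_def by auto
    show ?thesis
      using u_X[of v] X(1)[of v] unfolding V_eq Q_def by (intro exI[of _ "X v"]) (auto simp: Int_def)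
  qed
  ultimately have "P_point u"
    unfolding P_point_def free_ultrafilter_def ultrafilter_def using u_nonbot u_inf by blast
  then show ?thesis using u_F by blast
qed

section \<open>A filter above the whole increasing sequence\<close>

text \<open>This is the composite f k o f (k + 1) o ... o f (k + m - 1), which leads from level k +
  m down to level k. The recursion splits off the top map; the comparison of neighbouring levels
  needs the bottom one split off, as in \<open>descend_Suc_left\<close>.\<close>

primrec descend :: "(nat \<Rightarrow> nat \<Rightarrow> nat) \<Rightarrow> nat \<Rightarrow> nat \<Rightarrow> nat \<Rightarrow> nat" where
  "descend f k 0 y = y"
| "descend f k (Suc m) y = descend f k m (f (k + m) y)"

lemma descend_Suc_left: "descend f k (Suc m) y = f k (descend f (Suc k) m y)"
  by (induction m arbitrary: y) auto

text \<open>For every filter below F, the map \<open>g k\<close> witnesses that it is Rudin-Keisler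
  above \<open>p k\<close>. The explicit description of F by \<open>g\<close> and \<open>M\<close>
  is the form that \<open>P_point_extension\<close> takes.\<close>

lemma exists_common_RK_filter:
  fixes p :: "nat \<Rightarrow> nat filter"
  assumes nonbot: "\<And>k. p k \<noteq> bot" and RK: "\<And>k. p (Suc k) \<ge>\<^sub>R\<^sub>K p k"
  obtains F :: "nat filter" and g :: "nat \<Rightarrow> nat \<Rightarrow> nat" and M
  where "\<And>Q. eventually Q F \<longleftrightarrow> (\<exists>k. \<forall>\<^sub>F y in p k. \<forall>x. g k x = y \<and> x \<in> M k \<longrightarrow> Q x)"
    and "F \<noteq> bot"
proof -
  obtain f where f: "\<And>k A. \<forall>\<^sub>F y in p k. y \<in> A \<Longrightarrow> \<forall>\<^sub>F y in p (Suc k). y \<in> f k -` A"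
    using RK unfolding RK_ge_def by metis
  \<comment> \<open>A number x codes a pair (n, y), with y regarded as a point at level n. The
    truncated difference n - k counts the levels to descend only for n >= k, whence the restriction
    to \<open>M k\<close>.\<close>
  define g where "g k x = (case prod_decode x of (n, y) \<Rightarrow> descend f k (n - k) y)" for k x
  define M where "M k = {x. k \<le> fst (prod_decode x)}" for k
  define H where "H k = inf (filtercomap (g k) (p k)) (principal (M k))" for k
  have ev_H: "eventually Q (H k) \<longleftrightarrow> (\<forall>\<^sub>F y in p k. \<forall>x. g k x = y \<and> x \<in> M k \<longrightarrow> Q x)" for Q k
    unfolding H_def eventually_inf_principal eventually_filtercomap
    by (auto elim!: eventually_mono
        intro!: exI[of _ "\<lambda>y. \<forall>x. g k x = y \<and> x \<in> M k \<longrightarrow> Q x"])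
  \<comment> \<open>On \<open>M (Suc k)\<close> the map \<open>g k\<close> is \<open>f k\<close>
    after \<open>g (Suc k)\<close>. Hence the \<open>H k\<close> form a chain, and each set of their
    infimum F already lies in some \<open>H k\<close>.\<close>
  have "H (Suc k) \<le> H k" for k
  proof (rule filter_leI)
    fix Q assume "eventually Q (H k)"
    then have "\<forall>\<^sub>F y in p k. y \<in> {y. \<forall>x. g k x = y \<and> x \<in> M k \<longrightarrow> Q x}"
      by (simp add: ev_H)
    then have "\<forall>\<^sub>F y in p (Suc k). y \<in> f k -` {y. \<forall>x. g k x = y \<and> x \<in> M k \<longrightarrow> Q x}"
      by (rule f)
    moreover have "g k x = f k (g (Suc k) x) \<and> x \<in> M k" if "x \<in> M (Suc k)" for x
    proof -
      from that obtain m where "fst (prod_decode x) = Suc k + m"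
        unfolding M_def by (auto simp: le_iff_add)
      then show ?thesis
        by (auto simp: g_def M_def split_beta Suc_diff_le descend_Suc_left simp del: descend.simps(2))
    qed
    ultimately show "eventually Q (H (Suc k))"
      unfolding ev_H by (auto elim!: eventually_mono)
  qed
  then have anti: "antimono H" by (rule decseq_SucI)
  define F where "F = (INF k. H k)"
  have ev: "eventually Q F \<longleftrightarrow> (\<exists>k. eventually Q (H k))" for Q
  proof -
    have "\<exists>x\<in>UNIV. H x \<le> inf (H a) (H b)" for a b
      by (intro bexI[of _ "max a b"]) (auto intro!: antimonoD[OF anti])
    then show ?thesis unfolding F_def by (subst eventually_INF_base) auto
  qed
  have "F \<noteq> bot"
  proof
    assume "F = bot"
    then have "eventually (\<lambda>_. False) F" by simp
    then obtain k where "\<forall>\<^sub>F y in p k. \<forall>x. \<not> (g k x = y \<and> x \<in> M k)"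
      unfolding ev ev_H by auto
    \<comment> \<open>The code of (k, y) descends zero levels, so \<open>g k\<close> maps
      \<open>M k\<close> onto omega and no fibre is empty.\<close>
    moreover have "g k (prod_encode (k, y)) = y \<and> prod_encode (k, y) \<in> M k" for y
      by (simp add: g_def M_def)
    ultimately have "\<forall>\<^sub>F y in p k. False" by (elim eventually_mono) blast
    then show False using nonbot by simp
  qed
  with that ev ev_H show ?thesis by blast
qed

lemma RK_ge_trans:
  assumes "F \<ge>\<^sub>R\<^sub>K G" "G \<ge>\<^sub>R\<^sub>K K"
  shows "F \<ge>\<^sub>R\<^sub>K K"
proof -
  from assms obtain f g where
    "\<And>A. \<forall>\<^sub>F n in G. n \<in> A \<Longrightarrow> \<forall>\<^sub>F n in F. n \<in> f -` A"
    "\<And>A. \<forall>\<^sub>F n in K. n \<in> A \<Longrightarrow> \<forall>\<^sub>F n in G. n \<in> g -` A"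
    unfolding RK_ge_def by blast
  then show ?thesis
    unfolding RK_ge_def by (intro exI[of _ "g \<circ> f"]) (unfold vimage_comp[symmetric], blast)
qed

theorem theorem4:
  fixes p :: "nat \<Rightarrow> nat filter"
  assumes "bounding_number =o continuum"
    and "\<And>n. P_point (p n)"
    and "\<And>n. p (Suc n) >\<^sub>R\<^sub>K p n"
  shows "\<exists>u. P_point u \<and> (\<forall>n. u >\<^sub>R\<^sub>K p n)"
proof -
  have "p n \<noteq> bot" "p (Suc n) \<ge>\<^sub>R\<^sub>K p n" for n
    using assms(2,3) by (simp_all add: P_point_def free_ultrafilter_def ultrafilter_def RK_greater_def)
  then obtain F :: "nat filter" and g M where F: "F \<noteq> bot"
    and ev: "\<And>Q. eventually Q F \<longleftrightarrow> (\<exists>k. \<forall>\<^sub>F y in p k. \<forall>x. g k x = y \<and> x \<in> M k \<longrightarrow> Q x)"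
    by (rule exists_common_RK_filter) (rule that)
  obtain u where u: "P_point u" "u \<le> F"
    using P_point_extension[OF assms(1,2) ev F] by blast
  have ge: "u \<ge>\<^sub>R\<^sub>K p n" for n
    unfolding RK_ge_def
  proof (intro exI[of _ "g n"] allI impI)
    fix A assume "\<forall>\<^sub>F y in p n. y \<in> A"
    then have "\<forall>\<^sub>F x in F. x \<in> g n -` A"
      unfolding ev by (intro exI[of _ n]) (auto elim!: eventually_mono)
    then show "\<forall>\<^sub>F x in u. x \<in> g n -` A" using u(2) by (rule filter_leD[rotated])
  qed
  \<comment> \<open>Otherwise \<open>p n\<close> would be above u, hence above
    \<open>p (Suc n)\<close>, against the strict increase of p.\<close>
  have "\<not> p n \<ge>\<^sub>R\<^sub>K u" for n
    using RK_ge_trans[OF _ ge[of "Suc n"], of "p n"] assms(3)[of n] unfolding RK_greater_def by blast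
  then show ?thesis using u ge unfolding RK_greater_def by blast
qed

end
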